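(* Assume that $g:\mathbb{R}\to(0,+\infty)$ is a non-decreasing continuous function, and that $q\ge 0$, $\theta>0$, $C>0$ and $\tau>q\theta$ are constants. Then for any constant $a\in\mathbb{R}$ there exists a positive number $R$ such that the Cauchy problem $$v'(r)=C\,r^{-q}\left(\int_0^r s^{\tau-1}g(v(s))\,ds\right)^{\frac1\theta}\quad (0<r<R),\qquad v(0)=a,$$ admits a solution $v\in C^1[0,R)\cap C^2(0,R)$ with $v'(0)=0$, and $v'(r)>0$, $v''(r)>0$ for $r\in(0,R)$. Moreover, the following properties hold: (i) If $\tau>\theta(q+1)$, then $v\in C^2[0,R)$ with $v''(0)=0$. (ii) If $\tau=\theta(q+1)$, then $v\in C^2[0,R)$ with $v''(0)=C\left(\frac{g(a)}{\tau}\right)^{\frac1\theta}$. (iii) If $\tau<\theta(q+1)$, then $v\in C^2(0,R)\cap W^{2,\delta}(0,R)$, where $\delta\in\left(1,\frac{\theta}{\theta(q+1)-\tau}\right)$.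
   Context: $W^{2,\delta}(0,R)$ denotes the usual Sobolev space on the interval $(0,R)$. *)

theory Defs
  imports "HOL-Analysis.Analysis"
begin

text \<open>
  The iterated derivative of a real function is taken relative to a set \<open>S\<close>: it is the one-sided
  derivative at an endpoint belonging to \<open>S\<close> and the ordinary derivative at interior points.
\<close>

primrec nderiv :: "real set \<Rightarrow> nat \<Rightarrow> (real \<Rightarrow> real) \<Rightarrow> real \<Rightarrow> real" where
  "nderiv S 0 f = f"
| "nderiv S (Suc k) f = (\<lambda>x. vector_derivative (nderiv S k f) (at x within S))"

definition C_k_on :: "nat \<Rightarrow> real set \<Rightarrow> (real \<Rightarrow> real) \<Rightarrow> bool" where
  "C_k_on k S f \<longleftrightarrow>
     (\<forall>j<k. \<forall>x\<in>S. nderiv S j f differentiable (at x within S)) \<and>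
     (\<forall>j\<le>k. continuous_on S (nderiv S j f))"

definition test_function_on :: "real set \<Rightarrow> (real \<Rightarrow> real) \<Rightarrow> bool" where
  "test_function_on S \<phi> \<longleftrightarrow>
     (\<forall>k. C_k_on k UNIV \<phi>) \<and> compact (closure {x. \<phi> x \<noteq> 0}) \<and> closure {x. \<phi> x \<noteq> 0} \<subseteq> S"

definition locally_integrable_on :: "real set \<Rightarrow> (real \<Rightarrow> real) \<Rightarrow> bool" where
  "locally_integrable_on S u \<longleftrightarrow> (\<forall>K. compact K \<and> K \<subseteq> S \<longrightarrow> set_integrable lebesgue K u)"

definition weak_nderiv_on :: "real set \<Rightarrow> nat \<Rightarrow> (real \<Rightarrow> real) \<Rightarrow> (real \<Rightarrow> real) \<Rightarrow> bool" where
  "weak_nderiv_on S k u w \<longleftrightarrow>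
     locally_integrable_on S u \<and> locally_integrable_on S w \<and>
     (\<forall>\<phi>. test_function_on S \<phi> \<longrightarrow>
        (LINT x:S|lebesgue. u x * nderiv UNIV k \<phi> x) =
        (- 1) ^ k * (LINT x:S|lebesgue. w x * \<phi> x))"

text \<open>
  Elements of Lebesgue and Sobolev spaces are represented by functions, not by classes modulo
  equality almost everywhere. The values of a representative outside \<open>S\<close> are irrelevant.
\<close>

definition Lp_on :: "real \<Rightarrow> real set \<Rightarrow> (real \<Rightarrow> real) set" where
  "Lp_on p S = {u. set_borel_measurable lebesgue S u \<and>
                   set_integrable lebesgue S (\<lambda>x. \<bar>u x\<bar> powr p)}"

definition Sobolev_on :: "nat \<Rightarrow> real \<Rightarrow> real set \<Rightarrow> (real \<Rightarrow> real) set" where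
  "Sobolev_on k p S = {u. u \<in> Lp_on p S \<and> (\<forall>j\<in>{1..k}. \<exists>w\<in>Lp_on p S. weak_nderiv_on S j u w)}"

end

theory Submission
  imports Defs
begin

text \<open>
  Write \<open>T u r = a + \<integral>\<^sub>0\<^sup>r slope u\<close>, where
  \<open>slope u t = C t\<^bsup>-q\<^esup> (\<integral>\<^sub>0\<^sup>t s\<^bsup>\<tau>-1\<^esup> g (u s) ds)\<^bsup>1/\<theta>\<^esup>\<close>; a solution is a fixed point of \<open>T\<close>.
  Since \<open>g\<close> is only continuous, \<open>T\<close> need not be a contraction, but since \<open>g\<close> is non-decreasing,
  \<open>T\<close> is order preserving. Put \<open>p = \<tau>/\<theta> - q > 0\<close>. If \<open>u \<le> a + 1\<close> then \<open>slope u t \<le> K t\<^bsup>p\<^esup>\<close>, so for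
  small \<open>R\<close> the operator, with values kept constant beyond \<open>R\<close>, maps the monotone functions with values in
  \<open>[a, a + 1]\<close> into themselves. These form a complete lattice under pointwise suprema, and the
  Knaster-Tarski argument (\<open>T_has_fixed_point\<close>) yields a fixed point \<open>v\<close> without any
  compactness or uniqueness.

  Everything else comes from the quotient \<open>mean v t\<close> of the inner integral by \<open>t\<^bsup>\<tau>\<^esup>\<close>. As \<open>g \<circ> v\<close>
  is non-decreasing, \<open>g a / \<tau> \<le> mean v t \<le> g (v t) / \<tau>\<close> (\<open>mean_bounds\<close>), and hence the quotient
  tends to \<open>g a / \<tau>\<close> at \<open>0\<close>. For \<open>t > 0\<close>
  \<open>v' = C t\<^bsup>p\<^esup> mean\<^bsup>1/\<theta>\<^esup>\<close> and \<open>v'' = (v' / t) (g v / (\<theta> mean) - q)\<close>,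
  where the last factor lies between \<open>p\<close> and a constant (\<open>curv_factor_bounds\<close>). The lower bound
  makes \<open>v''\<close> positive. If \<open>p \<ge> 1\<close>, both \<open>v'/t\<close> and \<open>v''\<close> have the limit asserted for
  \<open>v''(0)\<close>. If \<open>p < 1\<close>, the upper bound gives \<open>v'' \<le> M t\<^bsup>p-1\<^esup>\<close>, whose power \<open>\<delta>\<close> is integrable exactly
  when \<open>\<delta> (1 - p) < 1\<close>; the classical derivatives on the open interval are weak derivatives
  by integration by parts (\<open>C_k_on_imp_weak_nderiv_on\<close>).
\<close>

section \<open>Iterated derivatives relative to an interval\<close>

lemma interval_not_singleton:
  fixes a b y :: real
  assumes "a < b"
  shows "{a..<b} \<noteq> {y}" "{a<..<b} \<noteq> {y}"
  using infinite_Ico[OF assms] infinite_Ioo[OF assms] by (metis finite.emptyI finite_insert)+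

text \<open>
  Every point of a connected set with more than one element is a limit point of the set, so
  derivatives relative to such a set are unique.
\<close>

lemma vector_derivative_within_connected:
  fixes S :: "real set"
  assumes S: "connected S" "\<And>y. S \<noteq> {y}" and x: "x \<in> S"
    and d: "(f has_vector_derivative d) (at x within S)"
  shows "vector_derivative f (at x within S) = d"
proof -
  have "x islimpt S" using connected_imp_perfect S x by blast
  then have "at x within S \<noteq> bot" by (simp add: trivial_limit_within)
  then show ?thesis using d by (rule vector_derivative_within)
qed

text \<open>
  A derivative relative to \<open>S\<close> at a point of \<open>S\<close> sees only the values on \<open>S\<close>. Thus the iterated
  derivative, a choice operator applied repeatedly, can be replaced on \<open>S\<close>
  by an explicit function \<open>h\<close> before the next differentiation.
\<close>

lemma nderiv_Suc_eqI:
  assumes S: "connected S" "\<And>y. S \<noteq> {y}"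
    and eq: "\<And>x. x \<in> S \<Longrightarrow> nderiv S k f x = h x"
    and d: "\<And>x. x \<in> S \<Longrightarrow> (h has_vector_derivative h' x) (at x within S)"
    and x: "x \<in> S"
  shows "(nderiv S k f has_vector_derivative h' x) (at x within S)"
    and "nderiv S (Suc k) f x = h' x"
proof -
  show *: "(nderiv S k f has_vector_derivative h' x) (at x within S)"
    using x eq d[OF x] by (rule has_vector_derivative_transform)
  show "nderiv S (Suc k) f x = h' x"
    using vector_derivative_within_connected[OF S x *] by simp
qed

lemma C_k_on_0: "C_k_on 0 S f \<longleftrightarrow> continuous_on S f"
  by (simp add: C_k_on_def)

lemma C_k_on_SucI:
  assumes S: "connected S" "\<And>y. S \<noteq> {y}" and C: "C_k_on k S f"
    and eq: "\<And>x. x \<in> S \<Longrightarrow> nderiv S k f x = h x"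
    and d: "\<And>x. x \<in> S \<Longrightarrow> (h has_vector_derivative h' x) (at x within S)"
    and cont: "continuous_on S h'"
  shows "C_k_on (Suc k) S f"
proof -
  note * = nderiv_Suc_eqI[OF S, of k f h h', OF eq d]
  have "nderiv S k f differentiable (at x within S)" if "x \<in> S" for x
    using *(1)[OF _ _ that] by (rule differentiableI_vector)
  moreover have "continuous_on S (nderiv S (Suc k) f)"
    using cont *(2) by (metis (no_types, lifting) continuous_on_cong)
  ultimately show ?thesis
    using C unfolding C_k_on_def by (metis le_Suc_eq less_Suc_eq)
qed

lemma C_k_on_has_nderiv:
  assumes "C_k_on k S f" "j < k" "x \<in> S"
  shows "(nderiv S j f has_vector_derivative nderiv S (Suc j) f x) (at x within S)"
proof -
  have "nderiv S j f differentiable (at x within S)" using assms unfolding C_k_on_def by blast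
  then show ?thesis by (simp add: vector_derivative_works)
qed

section \<open>Classical derivatives are weak derivatives\<close>

text \<open>
  The complement of the support is open, so all derivatives vanish along with the function there.
\<close>

lemma nderiv_eq_0_off_support:
  assumes "x \<notin> closure {x. \<phi> x \<noteq> 0}"
  shows "nderiv UNIV k \<phi> x = 0"
  using assms
proof (induction k arbitrary: x)
  case 0
  then have "x \<notin> {x. \<phi> x \<noteq> 0}" by (rule contra_subsetD[OF closure_subset])
  then show ?case by simp
next
  case (Suc k)
  let ?U = "- closure {x. \<phi> x \<noteq> 0}"
  have "((\<lambda>_. 0::real) has_vector_derivative 0) (at x)" by simp
  then have "(nderiv UNIV k \<phi> has_vector_derivative 0) (at x)"
  proof (rule has_vector_derivative_transform_within_open)
    show "open ?U" "x \<in> ?U" using Suc.prems by auto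
    show "0 = nderiv UNIV k \<phi> y" if "y \<in> ?U" for y using Suc.IH[of y] that by simp
  qed
  then show ?case by (simp add: vector_derivative_at)
qed

text \<open>
  The margin between \<open>K\<close> and the endpoints \<open>c\<close>, \<open>d\<close> makes the boundary terms vanish when one
  integrates by parts over \<open>[c, d]\<close> against a function supported in \<open>K\<close>.
\<close>

lemma compact_subset_open_interval:
  fixes K :: "real set"
  assumes "compact K" "K \<subseteq> {\<alpha><..<\<beta>}" "\<alpha> < \<beta>"
  obtains c d where "c \<le> d" "K \<subseteq> {c<..<d}" "{c..d} \<subseteq> {\<alpha><..<\<beta>}"
proof (cases "K = {}")
  case True
  then show ?thesis using that[of "(\<alpha>+\<beta>)/2" "(\<alpha>+\<beta>)/2"] assms(3) by auto
next
  case False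
  obtain m where m: "m \<in> K" "\<And>x. x \<in> K \<Longrightarrow> m \<le> x"
    using compact_attains_inf[OF assms(1) False] by blast
  obtain M where M: "M \<in> K" "\<And>x. x \<in> K \<Longrightarrow> x \<le> M"
    using compact_attains_sup[OF assms(1) False] by blast
  have "\<alpha> < m" "M < \<beta>" "m \<le> M" using m M assms(2) by auto
  \<comment> \<open>Halve the gap on either side of \<open>K\<close>.\<close>
  show ?thesis
  proof (rule that[of "(\<alpha>+m)/2" "(M+\<beta>)/2"])
    show "(\<alpha>+m)/2 \<le> (M+\<beta>)/2" using \<open>\<alpha> < m\<close> \<open>M < \<beta>\<close> \<open>m \<le> M\<close> by simp
    show "K \<subseteq> {(\<alpha>+m)/2<..<(M+\<beta>)/2}"
    proof
      fix x assume "x \<in> K"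
      then show "x \<in> {(\<alpha>+m)/2<..<(M+\<beta>)/2}"
        using m(2)[of x] M(2)[of x] \<open>\<alpha> < m\<close> \<open>M < \<beta>\<close> by auto
    qed
    show "{(\<alpha>+m)/2..(M+\<beta>)/2} \<subseteq> {\<alpha><..<\<beta>}"
      using \<open>\<alpha> < m\<close> \<open>M < \<beta>\<close> by auto
  qed
qed

text \<open>
  The function \<open>f\<close> may be singular at the ends of \<open>S\<close>. The integrands vanish off \<open>K\<close>, so the
  integrals reduce to a compact interval inside \<open>S\<close>, on which all functions are continuous.
\<close>

lemma integration_by_parts_compact_support:
  fixes f \<psi> :: "real \<Rightarrow> real"
  assumes f: "\<And>x. x \<in> S \<Longrightarrow> (f has_vector_derivative f' x) (at x)" "continuous_on S f'"
    and \<psi>: "\<And>x. (\<psi> has_vector_derivative \<psi>' x) (at x)" "continuous_on UNIV \<psi>'"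
    and K: "compact K" "K \<subseteq> S" and S: "S = {\<alpha><..<\<beta>}" "\<alpha> < \<beta>"
    and off: "\<And>x. x \<notin> K \<Longrightarrow> \<psi> x = 0" "\<And>x. x \<notin> K \<Longrightarrow> \<psi>' x = 0"
  shows "(LINT x:S|lebesgue. f x * \<psi>' x) = - (LINT x:S|lebesgue. f' x * \<psi> x)"
proof -
  obtain c d where cd: "c \<le> d" "K \<subseteq> {c<..<d}" "{c..d} \<subseteq> S"
    using compact_subset_open_interval K S by metis
  have restrict: "(LINT x:S|lebesgue. h x) = (LINT x:{c..d}|lebesgue. h x)"
    if "\<And>x. x \<notin> K \<Longrightarrow> h x = 0" for h :: "real \<Rightarrow> real"
  proof -
    have "indicat_real S x *\<^sub>R h x = indicat_real {c..d} x *\<^sub>R h x" for x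
      using cd that[of x] by (cases "x \<in> K") (auto simp: indicator_def)
    then show ?thesis by (simp only: set_lebesgue_integral_def)
  qed
  have fc: "continuous_on {c..d} f"
    by (rule continuous_on_vector_derivative[where f' = f'], rule has_vector_derivative_at_within)
       (use f(1) cd(3) in blast)
  have \<psi>c: "continuous_on {c..d} \<psi>"
    using has_vector_derivative_at_within[OF \<psi>(1)]
    by (rule continuous_on_vector_derivative)
  have i1: "(\<lambda>x. f x * \<psi>' x) absolutely_integrable_on {c..d}"
    using fc continuous_on_subset[OF \<psi>(2) subset_UNIV]
    by (intro absolutely_integrable_continuous_real continuous_on_mult)
  have i2: "(\<lambda>x. f' x * \<psi> x) absolutely_integrable_on {c..d}"
    using \<psi>c continuous_on_subset[OF f(2) cd(3)]
    by (intro absolutely_integrable_continuous_real continuous_on_mult)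
  have "((\<lambda>x. f x * \<psi>' x + f' x * \<psi> x) has_integral f d * \<psi> d - f c * \<psi> c) {c..d}"
  proof (rule fundamental_theorem_of_calculus[OF cd(1)])
    fix x assume "x \<in> {c..d}"
    then show "((\<lambda>x. f x * \<psi> x) has_vector_derivative f x * \<psi>' x + f' x * \<psi> x)
        (at x within {c..d})"
      using has_vector_derivative_mult[OF f(1) \<psi>(1)] cd(3)
      by (blast intro: has_vector_derivative_at_within)
  qed
  moreover have "\<psi> c = 0" "\<psi> d = 0" using cd(2) by (auto intro!: off(1))
  ultimately have "integral {c..d} (\<lambda>x. f x * \<psi>' x + f' x * \<psi> x) = 0"
    by (simp add: integral_unique)
  then have "(LINT x:{c..d}|lebesgue. f x * \<psi>' x) + (LINT x:{c..d}|lebesgue. f' x * \<psi> x) = 0"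
    using i1 i2 by (simp add: set_lebesgue_integral_eq_integral Henstock_Kurzweil_Integration.integral_add)
  then show ?thesis using restrict off by simp
qed

lemma continuous_on_imp_locally_integrable_on:
  assumes "continuous_on S u"
  shows "locally_integrable_on S u"
  unfolding locally_integrable_on_def
proof (intro allI impI)
  fix K assume K: "compact K \<and> K \<subseteq> S"
  then have "continuous_on K u" using assms continuous_on_subset by blast
  then have "set_integrable lborel K u"
    unfolding set_integrable_def using K by (intro borel_integrable_compact) auto
  then show "set_integrable lebesgue K u"
    using K by (simp add: set_integrable_def integrable_completion)
qed

text \<open>
  Integration by parts moves the derivatives from the test function to \<open>u\<close> one at a time; the
  induction is on the number \<open>j\<close> of derivatives already moved.
\<close>

lemma C_k_on_imp_weak_nderiv_on:
  assumes u: "C_k_on k S u" and S: "S = {\<alpha><..<\<beta>}" "\<alpha> < \<beta>"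
  shows "weak_nderiv_on S k u (nderiv S k u)"
  unfolding weak_nderiv_on_def
proof (intro conjI allI impI)
  have "continuous_on S (nderiv S j u)" if "j \<le> k" for j using u that by (simp add: C_k_on_def)
  then have cont: "continuous_on S u" "\<And>j. j \<le> k \<Longrightarrow> continuous_on S (nderiv S j u)"
    by (metis le0 nderiv.simps(1), simp)
  show "locally_integrable_on S u" "locally_integrable_on S (nderiv S k u)"
    using cont by (simp_all add: continuous_on_imp_locally_integrable_on)
  fix \<phi> assume \<phi>: "test_function_on S \<phi>"
  let ?K = "closure {x. \<phi> x \<noteq> 0}"
  have C: "\<And>k. C_k_on k UNIV \<phi>" and K: "compact ?K" "?K \<subseteq> S"
    using \<phi> by (auto simp: test_function_on_def)
  have "(LINT x:S|lebesgue. u x * nderiv UNIV k \<phi> x) =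
      (-1) ^ j * (LINT x:S|lebesgue. nderiv S j u x * nderiv UNIV (k - j) \<phi> x)" if "j \<le> k" for j
    using that
  proof (induction j)
    case 0
    then show ?case by simp
  next
    case (Suc j)
    define i where "i = k - Suc j"
    have i: "k - j = Suc i" using Suc.prems by (simp add: i_def)
    have "(LINT x:S|lebesgue. nderiv S j u x * nderiv UNIV (Suc i) \<phi> x) =
        - (LINT x:S|lebesgue. nderiv S (Suc j) u x * nderiv UNIV i \<phi> x)"
    proof (rule integration_by_parts_compact_support[OF _ _ _ _ K S])
      fix x
      show "(nderiv S j u has_vector_derivative nderiv S (Suc j) u x) (at x)" if "x \<in> S"
        using C_k_on_has_nderiv[OF u _ that, of j] Suc.prems that
        by (metis S(1) Suc_le_lessD at_within_open open_greaterThanLessThan)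
      show "(nderiv UNIV i \<phi> has_vector_derivative nderiv UNIV (Suc i) \<phi> x) (at x)"
        using C_k_on_has_nderiv[OF C, of i "Suc i"] by simp
      show "continuous_on S (nderiv S (Suc j) u)" using cont Suc.prems by blast
      show "continuous_on UNIV (nderiv UNIV (Suc i) \<phi>)"
        using C[of "Suc i"] unfolding C_k_on_def by blast
    qed (rule nderiv_eq_0_off_support, assumption)+
    then show ?case using Suc by (simp add: i i_def)
  qed
  from this[of k] show "(LINT x:S|lebesgue. u x * nderiv UNIV k \<phi> x) =
      (-1) ^ k * (LINT x:S|lebesgue. nderiv S k u x * \<phi> x)" by simp
qed

text \<open>
  The integrability test for a power singularity at the left endpoint. With \<open>e = 0\<close> it covers
  bounded functions.
\<close>

lemma Lp_on_dominated_by_powr: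
  assumes cont: "continuous_on {0<..<R} u" and "R > 0" "\<delta> > 0" "\<delta> * e > -1" "M \<ge> 0"
    and bound: "\<And>x. x \<in> {0<..<R} \<Longrightarrow> \<bar>u x\<bar> \<le> M * x powr e"
  shows "u \<in> Lp_on \<delta> {0<..<R}"
proof -
  have meas: "set_borel_measurable lebesgue {0<..<R} h"
    if "continuous_on {0<..<R} h" for h :: "real \<Rightarrow> real"
    unfolding set_borel_measurable_def
    using borel_measurable_continuous_on_indicator[OF _ that]
    by (intro measurable_completion) simp
  have "(\<lambda>x. x powr (\<delta> * e)) integrable_on {0..R}"
    using has_integral_powr_from_0[OF assms(4)] \<open>R > 0\<close> by (meson has_integral_integrable less_imp_le)
  then have "(\<lambda>x. x powr (\<delta> * e)) absolutely_integrable_on {0..R}"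
    by (rule nonnegative_absolutely_integrable_1) simp
  then have "(\<lambda>x. x powr (\<delta> * e)) absolutely_integrable_on {0<..<R}"
    by (rule set_integrable_subset) auto
  then have "(\<lambda>x. M powr \<delta> * x powr (\<delta> * e)) absolutely_integrable_on {0<..<R}"
    by (rule set_integrable_mult_right)
  moreover have "set_borel_measurable lebesgue {0<..<R} (\<lambda>x. \<bar>u x\<bar> powr \<delta>)"
    using \<open>\<delta> > 0\<close> by (intro meas continuous_on_powr' continuous_on_rabs cont continuous_on_const) auto
  ultimately have "set_integrable lebesgue {0<..<R} (\<lambda>x. \<bar>u x\<bar> powr \<delta>)"
  proof (rule set_integrable_bound, intro AE_I2 impI)
    fix x assume x: "x \<in> {0<..<R}"
    have "\<bar>u x\<bar> powr \<delta> \<le> (M * x powr e) powr \<delta>"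
      using bound[OF x] \<open>\<delta> > 0\<close> by (intro powr_mono2) auto
    also have "\<dots> = M powr \<delta> * x powr (\<delta> * e)"
      using x \<open>M \<ge> 0\<close> by (simp add: powr_mult powr_powr mult.commute)
    finally show "norm (\<bar>u x\<bar> powr \<delta>) \<le> norm (M powr \<delta> * x powr (\<delta> * e))" by simp
  qed
  then show ?thesis using meas[OF cont] by (simp add: Lp_on_def)
qed

section \<open>The monotone integral operator\<close>

locale radial_cauchy_problem =
  fixes g :: "real \<Rightarrow> real" and q \<theta> C \<tau> a :: real
  assumes g_pos: "\<And>x. g x > 0" and g_mono: "mono g" and g_cont: "continuous_on UNIV g"
    and q_nonneg: "q \<ge> 0" and \<theta>_pos: "\<theta> > 0" and C_pos: "C > 0" and \<tau>_gt: "\<tau> > q * \<theta>"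
begin

text \<open>
  The exponent \<open>p\<close> is the order of vanishing of \<open>v'\<close> at \<open>0\<close>. The trichotomy of \<open>\<tau>\<close> against
  \<open>\<theta> (q + 1)\<close> is that of \<open>p\<close> against \<open>1\<close>.
\<close>

definition p :: real where "p = \<tau> / \<theta> - q"

definition K :: real where "K = C * (g (a + 1) / \<tau>) powr (1 / \<theta>)"

text \<open>
  This choice gives \<open>R \<le> 1\<close>, hence \<open>slope u \<le> K\<close> on \<open>[0, R]\<close>, and \<open>K R \<le> 1\<close>, so that \<open>T u\<close> rises by
  at most \<open>1\<close>.
\<close>

definition R :: real where "R = 1 / (1 + K)"

definition flux :: "(real \<Rightarrow> real) \<Rightarrow> real \<Rightarrow> real" where
  "flux u t = integral {0..t} (\<lambda>s. s powr (\<tau> - 1) * g (u s))"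

definition slope :: "(real \<Rightarrow> real) \<Rightarrow> real \<Rightarrow> real" where
  "slope u t = C * t powr (- q) * flux u t powr (1 / \<theta>)"

definition mean :: "(real \<Rightarrow> real) \<Rightarrow> real \<Rightarrow> real" where
  "mean u t = flux u t / t powr \<tau>"

text \<open>
  Truncation at \<open>R\<close>, together with the emptiness of \<open>{0..r}\<close> for negative \<open>r\<close>, makes \<open>T u\<close> monotone on
  the whole line with values in \<open>[a, a + 1]\<close>.
\<close>

definition T :: "(real \<Rightarrow> real) \<Rightarrow> real \<Rightarrow> real" where
  "T u r = a + integral {0..min r R} (slope u)"

text \<open>
  Monotonicity is required because it survives arbitrary suprema, which measurability does not,
  and it implies measurability. It also gives the upper bound for \<open>mean\<close>.
\<close>

definition admissible :: "(real \<Rightarrow> real) \<Rightarrow> bool" where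
  "admissible u \<longleftrightarrow> mono u \<and> (\<forall>x. u x \<in> {a..a + 1})"

lemma \<tau>_pos: "\<tau> > 0"
  using q_nonneg \<theta>_pos \<tau>_gt by (smt (verit) mult_nonneg_nonneg)

lemma p_pos: "p > 0"
  using \<tau>_gt \<theta>_pos by (simp add: p_def field_simps)

lemma K_pos: "K > 0"
  using C_pos \<tau>_pos g_pos[of "a + 1"] by (simp add: K_def)

lemma R_pos: "R > 0" and R_le_1: "R \<le> 1" and K_R_le_1: "K * R \<le> 1"
  using K_pos by (simp_all add: R_def field_simps)

lemma weight_has_integral:
  "t \<ge> 0 \<Longrightarrow> ((\<lambda>s. s powr (\<tau> - 1)) has_integral t powr \<tau> / \<tau>) {0..t}"
  using has_integral_powr_from_0[of "\<tau> - 1" t] \<tau>_pos by simp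

lemma flux_integrand_absolutely_integrable:
  assumes u: "admissible u" and "t \<ge> 0"
  shows "(\<lambda>s. s powr (\<tau> - 1) * g (u s)) absolutely_integrable_on {0..t}"
proof -
  have "mono (\<lambda>s. g (u s))" using u g_mono by (auto simp: admissible_def mono_def)
  then have "(\<lambda>s. g (u s)) \<in> borel_measurable (lebesgue_on {0..t})"
    by (intro measurable_restrict_space1 measurable_completion) (simp add: borel_measurable_mono)
  moreover have "bounded ((\<lambda>s. g (u s)) ` {0..t})"
    unfolding bounded_iff using u g_mono g_pos
    by (intro exI[of _ "g (a + 1)"]) (auto simp: admissible_def mono_def less_imp_le)
  moreover have "(\<lambda>s. s powr (\<tau> - 1)) absolutely_integrable_on {0..t}"
    using weight_has_integral[OF \<open>t \<ge> 0\<close>]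
    by (intro nonnegative_absolutely_integrable_1) auto
  ultimately have "(\<lambda>s. g (u s) * s powr (\<tau> - 1)) absolutely_integrable_on {0..t}"
    by (intro absolutely_integrable_bounded_measurable_product_real) auto
  then show ?thesis by (simp add: mult.commute)
qed

lemma flux_integrand_integrable:
  "admissible u \<Longrightarrow> t \<ge> 0 \<Longrightarrow> (\<lambda>s. s powr (\<tau> - 1) * g (u s)) integrable_on {0..t}"
  using flux_integrand_absolutely_integrable set_lebesgue_integral_eq_integral(1) by blast

lemma flux_eq_LINT:
  "admissible u \<Longrightarrow> t \<ge> 0 \<Longrightarrow> (LINT s:{0..t}|lebesgue. s powr (\<tau> - 1) * g (u s)) = flux u t"
  unfolding flux_def
  by (rule set_lebesgue_integral_eq_integral(2)[OF flux_integrand_absolutely_integrable])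

lemma flux_nonneg: "admissible u \<Longrightarrow> t \<ge> 0 \<Longrightarrow> flux u t \<ge> 0"
  unfolding flux_def using g_pos
  by (intro integral_nonneg flux_integrand_integrable) (auto simp: less_imp_le)

lemma flux_mono:
  assumes "admissible u" "admissible w" "\<And>x. u x \<le> w x" "t \<ge> 0"
  shows "flux u t \<le> flux w t"
  unfolding flux_def using assms g_mono
  by (intro integral_le flux_integrand_integrable) (auto intro!: mult_left_mono dest: monoD)

text \<open>
  On \<open>[0, t]\<close> the monotone function \<open>g \<circ> u\<close> lies between \<open>g a\<close> and \<open>g (u t)\<close>, and the weight
  \<open>s\<^bsup>\<tau>-1\<^esup>\<close> has integral \<open>t\<^bsup>\<tau>\<^esup> / \<tau>\<close>.
\<close>

lemma mean_bounds:
  assumes u: "admissible u" and t: "t > 0"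
  shows "g a / \<tau> \<le> mean u t" "mean u t \<le> g (u t) / \<tau>"
proof -
  have w: "((\<lambda>s. s powr (\<tau> - 1) * c) has_integral t powr \<tau> / \<tau> * c) {0..t}" for c
    using weight_has_integral t by (intro has_integral_mult_left) auto
  note f = integrable_integral[OF flux_integrand_integrable[OF u less_imp_le[OF t]], folded flux_def]
  have "t powr \<tau> / \<tau> * g a \<le> flux u t"
    by (rule has_integral_le[OF w f])
       (use u g_mono in \<open>auto intro!: mult_left_mono simp: admissible_def mono_def\<close>)
  moreover have "flux u t \<le> t powr \<tau> / \<tau> * g (u t)"
    by (rule has_integral_le[OF f w])
       (use u g_mono in \<open>auto intro!: mult_left_mono simp: admissible_def mono_def\<close>)
  ultimately show "g a / \<tau> \<le> mean u t" "mean u t \<le> g (u t) / \<tau>"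
    using t \<tau>_pos by (simp_all add: mean_def field_simps)
qed

lemma mean_pos: "admissible u \<Longrightarrow> t > 0 \<Longrightarrow> mean u t > 0"
  using mean_bounds(1) g_pos \<tau>_pos by (meson divide_pos_pos less_le_trans)

lemma flux_pos: "admissible u \<Longrightarrow> t > 0 \<Longrightarrow> flux u t > 0"
  using mean_pos[of u t] by (simp add: mean_def zero_less_divide_iff)

text \<open>
  Factoring \<open>t\<^bsup>\<tau>\<^esup>\<close> out of the inner integral turns the singular factor \<open>t\<^bsup>-q\<^esup>\<close> into \<open>t\<^bsup>p\<^esup>\<close>, which
  vanishes at \<open>0\<close>.
\<close>

lemma slope_eq:
  assumes "admissible u" "t > 0"
  shows "slope u t = C * t powr p * mean u t powr (1 / \<theta>)"
proof -
  have "flux u t powr (1 / \<theta>) = (t powr \<tau> * mean u t) powr (1 / \<theta>)"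
    using assms by (simp add: mean_def)
  also have "\<dots> = t powr (\<tau> / \<theta>) * mean u t powr (1 / \<theta>)"
    using mean_pos[OF assms] by (simp add: powr_mult powr_powr)
  finally show ?thesis
    by (simp add: slope_def p_def diff_conv_add_uminus powr_add del: add_uminus_conv_diff)
qed

lemma slope_0 [simp]: "slope u 0 = 0"
  by (simp add: slope_def)

lemma slope_pos: "admissible u \<Longrightarrow> t > 0 \<Longrightarrow> slope u t > 0"
  using C_pos flux_pos[of u t] by (simp add: slope_def)

lemma slope_nonneg: "admissible u \<Longrightarrow> t \<ge> 0 \<Longrightarrow> slope u t \<ge> 0"
  using C_pos by (simp add: slope_def)

lemma slope_le:
  assumes u: "admissible u" and t: "t \<ge> 0"
  shows "slope u t \<le> K * t powr p"
proof (cases "t = 0")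
  case False
  then have t: "t > 0" using t by simp
  have "g (u t) \<le> g (a + 1)" using u g_mono by (auto simp: admissible_def mono_def)
  then have "mean u t \<le> g (a + 1) / \<tau>"
    using mean_bounds(2)[OF u t] \<tau>_pos by (meson divide_right_mono less_imp_le order_trans)
  then have "mean u t powr (1 / \<theta>) \<le> (g (a + 1) / \<tau>) powr (1 / \<theta>)"
    using mean_pos[OF u t] \<theta>_pos by (intro powr_mono2) auto
  then have "C * t powr p * mean u t powr (1 / \<theta>) \<le> C * t powr p * (g (a + 1) / \<tau>) powr (1 / \<theta>)"
    using C_pos by (intro mult_left_mono) auto
  then show ?thesis using slope_eq[OF u t] by (simp add: K_def mult_ac)
qed simp

lemma slope_le_K:
  assumes u: "admissible u" and t: "t \<in> {0..R}"
  shows "slope u t \<le> K"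
proof -
  have "t powr p \<le> 1 powr p" using t p_pos R_le_1 by (intro powr_mono2) auto
  then have "K * t powr p \<le> K" using K_pos by simp
  then show ?thesis using slope_le[OF u, of t] t by simp
qed

lemma slope_mono:
  assumes "admissible u" "admissible w" "\<And>x. u x \<le> w x" "t \<ge> 0"
  shows "slope u t \<le> slope w t"
  unfolding slope_def using assms C_pos \<theta>_pos flux_mono[OF assms] flux_nonneg[of u t]
  by (intro mult_left_mono powr_mono2) auto

lemma flux_continuous_on:
  assumes "admissible u"
  shows "continuous_on {0..R} (flux u)"
  unfolding flux_def[abs_def]
  using flux_integrand_integrable[OF assms] R_pos
  by (intro indefinite_integral_continuous_1) auto

text \<open>
  Away from \<open>0\<close> this is the continuity of an indefinite integral. At \<open>0\<close> the bound \<open>K t\<^bsup>p\<^esup>\<close> squeezes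
  the slope to \<open>0\<close>, which is also its value there because \<open>0 powr x = 0\<close>.
\<close>

lemma slope_continuous_on:
  assumes u: "admissible u"
  shows "continuous_on {0..R} (slope u)"
proof (rule continuous_on_eq_continuous_within[THEN iffD2], rule ballI)
  fix t assume t: "t \<in> {0..R}"
  show "continuous (at t within {0..R}) (slope u)"
  proof (cases "t = 0")
    case True
    have "((\<lambda>t. t powr p) \<longlongrightarrow> 0) (at 0 within {0..R})"
      using p_pos by (intro tendsto_zero_powrI[of _ _ _ p]) (auto simp: eventually_at_filter)
    then have "((\<lambda>t. K * t powr p) \<longlongrightarrow> 0) (at 0 within {0..R})"
      by (rule tendsto_mult_right_zero)
    then have "(slope u \<longlongrightarrow> 0) (at 0 within {0..R})"
      by (rule tendsto_sandwich[OF _ _ tendsto_const, rotated 2])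
         (use u slope_nonneg slope_le in \<open>auto simp: eventually_at_filter\<close>)
    then show ?thesis using True by (simp add: continuous_within)
  next
    case False
    then have "t > 0" using t by simp
    have "continuous (at t within {0..R}) (flux u)"
      using flux_continuous_on[OF u] t by (simp add: continuous_on_eq_continuous_within)
    then show ?thesis unfolding slope_def[abs_def]
      using \<open>t > 0\<close> flux_pos[OF u \<open>t > 0\<close>]
      by (auto intro!: continuous_intros tendsto_intros simp: continuous_within)
  qed
qed

lemma slope_integrable:
  assumes "admissible u" "r \<le> R"
  shows "slope u integrable_on {0..r}"
  by (rule integrable_continuous_real, rule continuous_on_subset[OF slope_continuous_on])
     (use assms in auto)

lemma T_admissible:
  assumes u: "admissible u"
  shows "admissible (T u)"
  unfolding admissible_def
proof (intro conjI allI)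
  have le: "integral {0..r} (slope u) \<le> integral {0..r'} (slope u)" if "r \<le> r'" "r' \<le> R" for r r'
    by (rule integral_subset_le) (use that u slope_integrable slope_nonneg in auto)
  show "mono (T u)"
    by (rule monoI) (simp add: T_def le)
  fix x
  have "integral {0..R} (slope u) \<le> integral {0..R} (\<lambda>_. K)"
    using slope_integrable[OF u] slope_le_K[OF u] by (intro integral_le) auto
  also have "\<dots> \<le> 1"
    using K_R_le_1 R_pos by (simp add: mult.commute)
  finally have "T u x \<le> a + 1" using le[of "min x R" R] by (simp add: T_def)
  moreover have "integral {0..min x R} (slope u) \<ge> 0"
    by (rule integral_nonneg) (use u slope_integrable slope_nonneg in auto)
  ultimately show "T u x \<in> {a..a + 1}" by (simp add: T_def)
qed

lemma T_mono:
  assumes "admissible u" "admissible w" "\<And>x. u x \<le> w x"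
  shows "T u r \<le> T w r"
  unfolding T_def
  by (intro add_left_mono integral_le) (use assms slope_mono slope_integrable in auto)

text \<open>
  The Knaster-Tarski argument: the pointwise supremum \<open>v\<close> of all admissible \<open>u \<le> T u\<close> satisfies \<open>v \<le> T v\<close> by
  monotonicity of \<open>T\<close>. Then \<open>T v\<close> is itself one of these \<open>u\<close>, so \<open>T v \<le> v\<close>.
\<close>

lemma T_has_fixed_point:
  obtains v where "admissible v" "T v = v"
proof -
  define A where "A = {u. admissible u \<and> (\<forall>x. u x \<le> T u x)}"
  define v where "v x = (SUP u\<in>A. u x)" for x
  have "admissible (\<lambda>_. a)" by (simp add: admissible_def mono_def)
  moreover from this have "a \<le> T (\<lambda>_. a) x" for x
    using T_admissible by (auto simp: admissible_def)
  ultimately have ne: "(\<lambda>_. a) \<in> A" by (simp add: A_def)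
  have bdd: "bdd_above ((\<lambda>u. u x) ` A)" for x
    by (intro bdd_aboveI[of _ "a + 1"]) (auto simp: A_def admissible_def)
  have upper: "u x \<le> v x" if "u \<in> A" for u x
    unfolding v_def using that bdd by (rule cSUP_upper)
  have least: "v x \<le> c" if "\<And>u. u \<in> A \<Longrightarrow> u x \<le> c" for x c
    unfolding v_def using ne that by (intro cSUP_least) auto
  have "mono v"
  proof (rule monoI, rule least)
    fix x y u assume "x \<le> (y::real)" "u \<in> A"
    then have "u x \<le> u y" by (simp add: A_def admissible_def monoD)
    also have "\<dots> \<le> v y" using \<open>u \<in> A\<close> by (rule upper)
    finally show "u x \<le> v y" .
  qed
  then have adm: "admissible v"
    using upper[OF ne] least by (auto simp: admissible_def A_def)
  have post: "v x \<le> T v x" for x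
  proof (rule least)
    fix u assume u: "u \<in> A"
    then have "u x \<le> T u x" by (simp add: A_def)
    also have "\<dots> \<le> T v x" using u upper[OF u] adm by (intro T_mono) (auto simp: A_def)
    finally show "u x \<le> T v x" .
  qed
  have "T v \<in> A" using T_admissible[OF adm] T_mono[OF adm T_admissible[OF adm] post]
    by (simp add: A_def)
  then have "T v x \<le> v x" for x by (rule upper)
  then show ?thesis using that adm post by (meson antisym ext)
qed

section \<open>Regularity of the fixed point\<close>

text \<open>
  The second derivative of the solution on \<open>(0, R)\<close>, written so that its sign and its size can
  be read off from those of \<open>slope u t / t\<close> and of the second factor.
\<close>

definition curv :: "(real \<Rightarrow> real) \<Rightarrow> real \<Rightarrow> real" where
  "curv u t = slope u t / t * (g (u t) / (\<theta> * mean u t) - q)"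

text \<open>
  The second derivative at \<open>0\<close> of the solution in the case \<open>p \<ge> 1\<close>.
\<close>

definition L :: real where "L = (if p = 1 then C * (g a / \<tau>) powr (1 / \<theta>) else 0)"

context
  fixes v
  assumes adm: "admissible v" and fixp: "T v = v"
begin

lemma v_eq: "r \<le> R \<Longrightarrow> v r = a + integral {0..r} (slope v)"
  using fixp unfolding T_def by (metis min.absorb1)

lemma v_0: "v 0 = a"
  using v_eq[of 0] R_pos by simp

lemma v_has_derivative:
  assumes "r \<in> {0..R}"
  shows "(v has_vector_derivative slope v r) (at r within {0..R})"
proof -
  have "((\<lambda>r. a + integral {0..r} (slope v)) has_vector_derivative 0 + slope v r) (at r within {0..R})"
    by (intro has_vector_derivative_add has_vector_derivative_const
          integral_has_vector_derivative slope_continuous_on adm assms)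
  then have "((\<lambda>r. a + integral {0..r} (slope v)) has_vector_derivative slope v r) (at r within {0..R})"
    by simp
  then show ?thesis
    by (rule has_vector_derivative_transform[rotated 2]) (use assms v_eq in auto)
qed

lemma v_continuous_on: "continuous_on {0..R} v"
  using v_has_derivative by (rule continuous_on_vector_derivative)

lemma gv_continuous_on: "continuous_on {0..R} (\<lambda>t. g (v t))"
  using continuous_on_compose2[OF g_cont v_continuous_on] by simp

lemma flux_has_derivative:
  assumes t: "t \<in> {0<..<R}"
  shows "(flux v has_real_derivative t powr (\<tau> - 1) * g (v t)) (at t)"
proof -
  have "continuous (at t within {0..R}) (\<lambda>t. g (v t))"
    using gv_continuous_on t by (simp add: continuous_on_eq_continuous_within)
  then have "continuous (at t within {0..R}) (\<lambda>s. s powr (\<tau> - 1) * g (v s))"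
    using t by (auto intro!: tendsto_intros simp: continuous_within)
  then have "(flux v has_vector_derivative t powr (\<tau> - 1) * g (v t)) (at t within {0..R})"
    using integral_has_vector_derivative_continuous_at
      [OF flux_integrand_integrable[OF adm less_imp_le[OF R_pos]], of t "{}"] t
    by (simp add: flux_def[abs_def])
  moreover have "at t within {0..R} = at t"
    using t by (intro at_within_interior) auto
  ultimately show ?thesis by (simp add: has_real_derivative_iff_has_vector_derivative)
qed

text \<open>
  Where \<open>v\<close> is continuous, the inner integral has derivative \<open>t\<^bsup>\<tau>-1\<^esup> g (v t)\<close>; the rest is the product
  and chain rule, the inner integral being positive.
\<close>

lemma slope_has_derivative:
  assumes t: "t \<in> {0<..<R}"
  shows "(slope v has_vector_derivative curv v t) (at t)"
proof -
  define f where "f = flux v t"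
  have pos: "t > 0" "f > 0" using t flux_pos[OF adm] by (auto simp: f_def)
  have "(slope v has_real_derivative
      C * (- q * t powr (- q - 1)) * f powr (1 / \<theta>) +
      C * t powr (- q) * (1 / \<theta> * f powr (1 / \<theta> - 1) * (t powr (\<tau> - 1) * g (v t)))) (at t)"
    unfolding slope_def[abs_def] f_def
    using pos[unfolded f_def] flux_has_derivative[OF t]
    by (auto intro!: derivative_eq_intros DERIV_chain2[OF has_real_derivative_powr])
  moreover have powers: "f powr (1 / \<theta> - 1) = f powr (1 / \<theta>) / f"
      "t powr (- q - 1) = t powr (- q) / t" "t powr (\<tau> - 1) = t powr \<tau> / t"
    using pos by (simp_all add: powr_diff)
  have "C * (- q * t powr (- q - 1)) * f powr (1 / \<theta>) +
      C * t powr (- q) * (1 / \<theta> * f powr (1 / \<theta> - 1) * (t powr (\<tau> - 1) * g (v t))) = curv v t"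
    unfolding powers curv_def slope_def mean_def f_def[symmetric]
    using pos \<theta>_pos by (simp add: field_simps)
  ultimately show ?thesis by (simp add: has_real_derivative_iff_has_vector_derivative)
qed

lemma curv_continuous_on: "continuous_on {0<..<R} (curv v)"
proof -
  have sub: "{0<..<R} \<subseteq> {0..R}" by auto
  note cont = continuous_on_subset[OF gv_continuous_on sub]
    continuous_on_subset[OF flux_continuous_on[OF adm] sub]
    continuous_on_subset[OF slope_continuous_on[OF adm] sub]
  have "continuous_on {0<..<R} (\<lambda>t. t powr \<tau>)" by (intro continuous_intros) auto
  then have "continuous_on {0<..<R} (mean v)"
    unfolding mean_def[abs_def] by (intro continuous_on_divide cont) auto
  then show ?thesis unfolding curv_def[abs_def]
    using mean_pos[OF adm] \<theta>_pos
    by (intro continuous_on_mult continuous_on_diff continuous_on_divide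
          continuous_on_const continuous_on_id cont) (auto simp: less_imp_neq[symmetric])
qed

text \<open>
  The estimate \<open>\<tau> mean \<le> g (v t)\<close> gives \<open>\<tau>/\<theta> - q = p\<close> as a lower bound: this is where the
  monotonicity of \<open>g\<close> forces \<open>v\<close> to be convex. The upper bound uses \<open>mean \<ge> g a / \<tau>\<close>.
\<close>

lemma curv_factor_bounds:
  assumes t: "t > 0"
  shows "p \<le> g (v t) / (\<theta> * mean v t) - q"
    and "g (v t) / (\<theta> * mean v t) - q \<le> \<tau> * g (a + 1) / (\<theta> * g a)"
proof -
  have m: "mean v t > 0" using mean_pos[OF adm t] .
  have "\<tau> * mean v t \<le> g (v t)"
    using mean_bounds(2)[OF adm t] \<tau>_pos by (simp add: field_simps)
  then show "p \<le> g (v t) / (\<theta> * mean v t) - q"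
    using m \<theta>_pos by (simp add: p_def field_simps)
  have "g (v t) \<le> g (a + 1)" using adm g_mono by (auto simp: admissible_def mono_def)
  then have "g (v t) / (\<theta> * mean v t) \<le> g (a + 1) / (\<theta> * (g a / \<tau>))"
    using mean_bounds(1)[OF adm t] g_pos \<theta>_pos \<tau>_pos
    by (intro frac_le mult_left_mono) (auto simp: less_imp_le)
  also have "\<dots> = \<tau> * g (a + 1) / (\<theta> * g a)" by simp
  finally show "g (v t) / (\<theta> * mean v t) - q \<le> \<tau> * g (a + 1) / (\<theta> * g a)"
    using q_nonneg by simp
qed

lemma curv_pos: "t > 0 \<Longrightarrow> curv v t > 0"
  unfolding curv_def using curv_factor_bounds(1)[of t] p_pos slope_pos[OF adm] by simp

lemma curv_le:
  assumes t: "t > 0"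
  shows "curv v t \<le> K * (\<tau> * g (a + 1) / (\<theta> * g a)) * t powr (p - 1)"
proof -
  have "slope v t / t \<le> K * t powr (p - 1)"
    using slope_le[OF adm, of t] t by (simp add: powr_diff field_simps)
  then have "curv v t \<le> (K * t powr (p - 1)) * (\<tau> * g (a + 1) / (\<theta> * g a))"
    unfolding curv_def using curv_factor_bounds[OF t] p_pos K_pos t
    by (intro mult_mono) auto
  then show ?thesis by (simp add: mult_ac)
qed

text \<open>
  Both bounds for the mean tend to the same limit, because \<open>v 0 = a\<close> and \<open>g \<circ> v\<close> is continuous.
\<close>

lemma mean_tendsto: "(mean v \<longlongrightarrow> g a / \<tau>) (at 0 within {0..R})"
proof (rule tendsto_sandwich[OF _ _ tendsto_const])
  show "\<forall>\<^sub>F t in at 0 within {0..R}. g a / \<tau> \<le> mean v t"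
    "\<forall>\<^sub>F t in at 0 within {0..R}. mean v t \<le> g (v t) / \<tau>"
    using mean_bounds[OF adm] by (auto simp: eventually_at_filter)
  have "((\<lambda>t. g (v t)) \<longlongrightarrow> g a) (at 0 within {0..R})"
    using gv_continuous_on R_pos v_0 by (auto simp: continuous_on)
  then show "((\<lambda>t. g (v t) / \<tau>) \<longlongrightarrow> g a / \<tau>) (at 0 within {0..R})"
    by (rule tendsto_divide) (use \<tau>_pos in auto)
qed

text \<open>
  By \<open>slope_eq\<close> the quotient is \<open>C t\<^bsup>p-1\<^esup> mean\<^bsup>1/\<theta>\<^esup>\<close>, where \<open>t\<^bsup>p-1\<^esup>\<close> tends to \<open>1\<close> if \<open>p = 1\<close> and to \<open>0\<close>
  if \<open>p > 1\<close>. The quotient is also the difference quotient of the slope at \<open>0\<close>.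
\<close>

lemma slope_quotient_tendsto:
  assumes "p \<ge> 1"
  shows "((\<lambda>t. slope v t / t) \<longlongrightarrow> L) (at 0 within {0..R})"
proof -
  have "((\<lambda>t. t powr (p - 1)) \<longlongrightarrow> (if p = 1 then 1 else 0)) (at 0 within {0..R})"
  proof (cases "p = 1")
    case True
    have "((\<lambda>t. t powr (p - 1)) \<longlongrightarrow> 1) (at 0 within {0..R})"
      by (rule tendsto_eventually) (simp add: True eventually_at_filter)
    then show ?thesis using True by simp
  next
    case False
    have "((\<lambda>t. t powr (p - 1)) \<longlongrightarrow> 0) (at 0 within {0..R})"
      using assms False
      by (intro tendsto_zero_powrI[of _ _ _ "p - 1"]) (auto simp: eventually_at_filter)
    then show ?thesis using False by simp
  qed
  moreover have "((\<lambda>t. mean v t powr (1 / \<theta>)) \<longlongrightarrow> (g a / \<tau>) powr (1 / \<theta>)) (at 0 within {0..R})"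
    using g_pos[of a] \<tau>_pos by (intro tendsto_powr mean_tendsto tendsto_const) auto
  ultimately have "((\<lambda>t. C * t powr (p - 1) * mean v t powr (1 / \<theta>)) \<longlongrightarrow>
      C * (if p = 1 then 1 else 0) * (g a / \<tau>) powr (1 / \<theta>)) (at 0 within {0..R})"
    by (intro tendsto_mult tendsto_const)
  moreover have "\<forall>\<^sub>F t in at 0 within {0..R}.
      C * t powr (p - 1) * mean v t powr (1 / \<theta>) = slope v t / t"
    by (auto simp: eventually_at_filter slope_eq[OF adm] powr_diff)
  ultimately show ?thesis by (auto simp: L_def intro: Lim_transform_eventually)
qed

lemma slope_has_derivative_0:
  assumes "p \<ge> 1"
  shows "(slope v has_vector_derivative L) (at 0 within {0..R})"
  using slope_quotient_tendsto[OF assms]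
  by (simp add: has_real_derivative_iff_has_vector_derivative[symmetric] has_field_derivative_iff)

text \<open>
  The factor multiplying the quotient tends to \<open>p\<close>. This leaves \<open>L\<close> unchanged, since either
  \<open>p = 1\<close> or \<open>L = 0\<close>.
\<close>

lemma curv_tendsto:
  assumes "p \<ge> 1"
  shows "(curv v \<longlongrightarrow> L) (at 0 within {0..R})"
proof -
  have "((\<lambda>t. g (v t)) \<longlongrightarrow> g a) (at 0 within {0..R})"
    using gv_continuous_on R_pos v_0 by (auto simp: continuous_on)
  then have "(curv v \<longlongrightarrow> L * (g a / (\<theta> * (g a / \<tau>)) - q)) (at 0 within {0..R})"
    unfolding curv_def[abs_def] using g_pos[of a] \<tau>_pos \<theta>_pos
    by (intro tendsto_mult slope_quotient_tendsto assms tendsto_diff tendsto_divide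
          mean_tendsto tendsto_const) auto
  moreover have "g a / (\<theta> * (g a / \<tau>)) - q = p"
    using g_pos[of a] by (simp add: p_def)
  moreover have "L * p = L" by (simp add: L_def)
  ultimately show ?thesis by (simp only:)
qed

lemma v_C1:
  shows "C_k_on 1 {0..<R} v" "r \<in> {0..<R} \<Longrightarrow> nderiv {0..<R} 1 v r = slope v r"
proof -
  have d: "(v has_vector_derivative slope v x) (at x within {0..<R})" if "x \<in> {0..<R}" for x
    by (rule has_vector_derivative_within_subset[OF v_has_derivative]) (use that in auto)
  have sub: "{0..<R} \<subseteq> {0..R}" by auto
  note conn = connected_Ico[of 0 R] interval_not_singleton(1)[OF R_pos]
  show "C_k_on 1 {0..<R} v" unfolding One_nat_def
    by (rule C_k_on_SucI[OF conn _ _ d])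
       (simp_all add: C_k_on_0 continuous_on_subset[OF v_continuous_on sub]
          continuous_on_subset[OF slope_continuous_on[OF adm] sub])
  show "nderiv {0..<R} 1 v r = slope v r" if "r \<in> {0..<R}" unfolding One_nat_def
    by (rule nderiv_Suc_eqI(2)[OF conn _ d that]) simp_all
qed

lemma v_C2_interior:
  shows "C_k_on 2 {0<..<R} v"
    and "r \<in> {0<..<R} \<Longrightarrow> nderiv {0<..<R} 1 v r = slope v r"
    and "r \<in> {0<..<R} \<Longrightarrow> nderiv {0<..<R} 2 v r = curv v r"
proof -
  have d: "(v has_vector_derivative slope v x) (at x within {0<..<R})" if "x \<in> {0<..<R}" for x
    by (rule has_vector_derivative_within_subset[OF v_has_derivative]) (use that in auto)
  have d2: "(slope v has_vector_derivative curv v x) (at x within {0<..<R})" if "x \<in> {0<..<R}" for x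
    by (rule has_vector_derivative_at_within[OF slope_has_derivative[OF that]])
  have sub: "{0<..<R} \<subseteq> {0..R}" by auto
  note conn = connected_Ioo[of 0 R] interval_not_singleton(2)[OF R_pos]
  have n1: "nderiv {0<..<R} (Suc 0) v x = slope v x" if "x \<in> {0<..<R}" for x
    by (rule nderiv_Suc_eqI(2)[OF conn _ d that]) simp_all
  then show "r \<in> {0<..<R} \<Longrightarrow> nderiv {0<..<R} 1 v r = slope v r" by simp
  show "nderiv {0<..<R} 2 v r = curv v r" if "r \<in> {0<..<R}"
    unfolding numeral_2_eq_2 by (rule nderiv_Suc_eqI(2)[OF conn n1 d2 that])
  have "C_k_on (Suc 0) {0<..<R} v"
    by (rule C_k_on_SucI[OF conn _ _ d])
       (simp_all add: C_k_on_0 continuous_on_subset[OF v_continuous_on sub]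
          continuous_on_subset[OF slope_continuous_on[OF adm] sub])
  then show "C_k_on 2 {0<..<R} v"
    unfolding numeral_2_eq_2 by (rule C_k_on_SucI[OF conn _ n1 d2 curv_continuous_on])
qed

text \<open>
  At \<open>0\<close> both the derivative of the slope and the limit of \<open>curv\<close> equal \<open>L\<close>, while the formula for
  \<open>curv\<close> has value \<open>0\<close> there, because \<open>x / 0 = 0\<close>; hence the function \<open>w\<close> that corrects this one value.
\<close>

lemma v_C2_up_to_0:
  assumes p: "p \<ge> 1"
  shows "C_k_on 2 {0..<R} v" "nderiv {0..<R} 2 v 0 = L"
proof -
  define w where "w t = (if t = 0 then L else curv v t)" for t
  note conn = connected_Ico[of 0 R] interval_not_singleton(1)[OF R_pos]
  have d: "(slope v has_vector_derivative w x) (at x within {0..<R})" if "x \<in> {0..<R}" for x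
  proof (cases "x = 0")
    case True
    have "(slope v has_vector_derivative L) (at 0 within {0..<R})"
      by (rule has_vector_derivative_within_subset[OF slope_has_derivative_0[OF p]]) auto
    then show ?thesis using True by (simp add: w_def)
  next
    case False
    then have x: "x \<in> {0<..<R}" using that by simp
    show ?thesis
      using has_vector_derivative_at_within[OF slope_has_derivative[OF x]] False
      by (simp add: w_def)
  qed
  have "continuous_on {0..<R} w"
    unfolding continuous_on_eq_continuous_within
  proof
    fix x assume x: "x \<in> {0..<R}"
    show "continuous (at x within {0..<R}) w"
    proof (cases "x = 0")
      case True
      have "(curv v \<longlongrightarrow> L) (at 0 within {0..<R})"
        by (rule tendsto_within_subset[OF curv_tendsto[OF p]]) auto
      then have "(w \<longlongrightarrow> L) (at 0 within {0..<R})"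
        by (rule Lim_transform_eventually) (simp add: w_def eventually_at_filter)
      then show ?thesis using True by (simp add: continuous_within w_def)
    next
      case False
      then have "x \<in> {0<..<R}" using x by auto
      moreover have "continuous_on {0<..<R} w"
        using curv_continuous_on by (rule continuous_on_eq) (auto simp: w_def)
      ultimately have "continuous (at x) w"
        by (simp add: continuous_on_eq_continuous_at)
      then show ?thesis by (rule continuous_at_imp_continuous_at_within)
    qed
  qed
  moreover have n1: "nderiv {0..<R} (Suc 0) v x = slope v x" if "x \<in> {0..<R}" for x
    using v_C1(2)[OF that] by simp
  ultimately show "C_k_on 2 {0..<R} v"
    unfolding numeral_2_eq_2 using v_C1(1) by (intro C_k_on_SucI[OF conn _ n1 d]) simp_all
  have "nderiv {0..<R} 2 v 0 = w 0"
    unfolding numeral_2_eq_2 by (rule nderiv_Suc_eqI(2)[OF conn n1 d]) (use R_pos in auto)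
  then show "nderiv {0..<R} 2 v 0 = L" by (simp add: w_def)
qed

text \<open>
  The function and its first derivative are bounded, so only \<open>v'' \<le> M t\<^bsup>p-1\<^esup>\<close> restricts \<open>\<delta>\<close>.
\<close>

lemma v_Sobolev:
  assumes \<delta>: "\<delta> > 0" "\<delta> * (p - 1) > -1"
  shows "v \<in> Sobolev_on 2 \<delta> {0<..<R}"
proof -
  have cont: "continuous_on {0<..<R} (nderiv {0<..<R} j v)" if "j \<le> 2" for j
    using v_C2_interior(1) that by (simp add: C_k_on_def)
  have "\<bar>v x\<bar> \<le> (\<bar>a\<bar> + 1) * x powr 0" if "x \<in> {0<..<R}" for x
  proof -
    have "v x \<in> {a..a + 1}" using adm by (simp add: admissible_def)
    then show ?thesis using that by auto
  qed
  then have L0: "v \<in> Lp_on \<delta> {0<..<R}"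
    using cont[of 0] R_pos \<delta> by (intro Lp_on_dominated_by_powr[of _ _ _ 0 "\<bar>a\<bar> + 1"]) auto
  have "\<bar>nderiv {0<..<R} 1 v x\<bar> \<le> K * x powr 0" if "x \<in> {0<..<R}" for x
    using slope_le_K[OF adm, of x] slope_nonneg[OF adm, of x] v_C2_interior(2)[OF that] that by auto
  then have L1: "nderiv {0<..<R} 1 v \<in> Lp_on \<delta> {0<..<R}"
    using cont[of 1] R_pos K_pos \<delta> by (intro Lp_on_dominated_by_powr[of _ _ _ 0 K]) auto
  have "\<bar>nderiv {0<..<R} 2 v x\<bar> \<le> K * (\<tau> * g (a + 1) / (\<theta> * g a)) * x powr (p - 1)"
    if "x \<in> {0<..<R}" for x
    using curv_le[of x] curv_pos[of x] v_C2_interior(3)[OF that] that by auto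
  then have L2: "nderiv {0<..<R} 2 v \<in> Lp_on \<delta> {0<..<R}"
    using cont[of 2] R_pos K_pos \<delta> \<tau>_pos \<theta>_pos less_imp_le[OF g_pos]
    by (intro Lp_on_dominated_by_powr[of _ _ _ "p - 1" "K * (\<tau> * g (a + 1) / (\<theta> * g a))"]) auto
  have weak: "weak_nderiv_on {0<..<R} j v (nderiv {0<..<R} j v)" if "j \<le> 2" for j
    using v_C2_interior(1) that R_pos
    by (intro C_k_on_imp_weak_nderiv_on[OF _ refl]) (auto simp: C_k_on_def)
  have "\<exists>w\<in>Lp_on \<delta> {0<..<R}. weak_nderiv_on {0<..<R} j v w" if "j \<in> {1..2}" for j
  proof -
    have "j = 1 \<or> j = 2" using that by auto
    then show ?thesis using L1 L2 weak[of j] by auto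
  qed
  then show ?thesis using L0 by (simp add: Sobolev_on_def)
qed

end

end

theorem theorem1p1:
  fixes g :: "real \<Rightarrow> real" and q \<theta> C \<tau> a :: real
  assumes "\<And>x. g x > 0" and "mono g" and "continuous_on UNIV g"
    and "q \<ge> 0" and "\<theta> > 0" and "C > 0" and "\<tau> > q * \<theta>"
  shows "\<exists>R>0. \<exists>v :: real \<Rightarrow> real.
     (\<forall>r\<in>{0<..<R}. nderiv {0..<R} 1 v r =
        C * r powr (- q) * (LINT s:{0..r}|lebesgue. s powr (\<tau> - 1) * g (v s)) powr (1 / \<theta>)) \<and>
     v 0 = a \<and>
     C_k_on 1 {0..<R} v \<and> C_k_on 2 {0<..<R} v \<and>
     nderiv {0..<R} 1 v 0 = 0 \<and>
     (\<forall>r\<in>{0<..<R}. nderiv {0<..<R} 1 v r > 0 \<and> nderiv {0<..<R} 2 v r > 0) \<and>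
     (\<tau> > \<theta> * (q + 1) \<longrightarrow> C_k_on 2 {0..<R} v \<and> nderiv {0..<R} 2 v 0 = 0) \<and>
     (\<tau> = \<theta> * (q + 1) \<longrightarrow>
        C_k_on 2 {0..<R} v \<and> nderiv {0..<R} 2 v 0 = C * (g a / \<tau>) powr (1 / \<theta>)) \<and>
     (\<tau> < \<theta> * (q + 1) \<longrightarrow>
        C_k_on 2 {0<..<R} v \<and>
        (\<forall>\<delta>\<in>{1<..<\<theta> / (\<theta> * (q + 1) - \<tau>)}. v \<in> Sobolev_on 2 \<delta> {0<..<R}))"
proof -
  interpret radial_cauchy_problem g q \<theta> C \<tau> a
    using assms by unfold_locales
  obtain v where v: "admissible v" "T v = v" by (rule T_has_fixed_point)
  note C1 = v_C1[OF v] and C2 = v_C2_interior[OF v] and C2_0 = v_C2_up_to_0[OF v]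
  have p1: "p > 1 \<longleftrightarrow> \<tau> > \<theta> * (q + 1)" "p = 1 \<longleftrightarrow> \<tau> = \<theta> * (q + 1)"
    using \<open>\<theta> > 0\<close> by (auto simp: p_def field_simps)
  have "0 \<in> {0..<R}" using R_pos by simp
  then have "nderiv {0..<R} 1 v 0 = 0" using C1(2) by simp
  moreover have "nderiv {0..<R} 1 v r =
        C * r powr (- q) * (LINT s:{0..r}|lebesgue. s powr (\<tau> - 1) * g (v s)) powr (1 / \<theta>)"
    if "r \<in> {0<..<R}" for r
    using C1(2)[of r] that flux_eq_LINT[OF v(1), of r] by (simp add: slope_def)
  moreover have "nderiv {0<..<R} 1 v r > 0 \<and> nderiv {0<..<R} 2 v r > 0" if "r \<in> {0<..<R}" for r
    using C2(2,3)[OF that] slope_pos[OF v(1)] curv_pos[OF v] that by simp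
  moreover have "C_k_on 2 {0..<R} v \<and> nderiv {0..<R} 2 v 0 = 0" if "\<tau> > \<theta> * (q + 1)"
    using C2_0 p1(1)[THEN iffD2, OF that] by (simp add: L_def)
  moreover have "C_k_on 2 {0..<R} v \<and> nderiv {0..<R} 2 v 0 = C * (g a / \<tau>) powr (1 / \<theta>)"
    if "\<tau> = \<theta> * (q + 1)"
    using C2_0 p1(2)[THEN iffD2, OF that] by (simp add: L_def)
  moreover have "v \<in> Sobolev_on 2 \<delta> {0<..<R}"
    if "\<tau> < \<theta> * (q + 1)" "\<delta> \<in> {1<..<\<theta> / (\<theta> * (q + 1) - \<tau>)}" for \<delta>
  proof (rule v_Sobolev[OF v])
    show "\<delta> > 0" using that by simp
    have "\<delta> * (\<theta> * (q + 1) - \<tau>) < \<theta>" using that by (simp add: pos_less_divide_eq)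
    then have "\<delta> * (\<theta> * (q + 1) - \<tau>) / \<theta> < 1" using \<open>\<theta> > 0\<close> by simp
    moreover have "p - 1 = - ((\<theta> * (q + 1) - \<tau>) / \<theta>)"
      using \<open>\<theta> > 0\<close> by (simp add: p_def field_simps)
    ultimately show "\<delta> * (p - 1) > - 1" by simp
  qed
  ultimately show ?thesis
    using R_pos v_0[OF v] C1(1) C2(1) by (intro exI[of _ R] exI[of _ v] conjI) blast+
qed

end
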